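(* Let $\mathcal{X}\in\{\mathrm{III},\mathrm{IV},\mathrm{V},\mathrm{VI}\}$, let $(\varepsilon,A,k,t)$ be admissible parameters of Type $\mathcal{X}$, and let $P=P_{\mathcal{X}}(\varepsilon,A,k,t)$, with $L(P)=K_{\mathcal{X}}(\delta_{\mathcal{X}},\varepsilon,A,k,t)$. Then $$\mathrm{area}(P)-\mathrm{coef}(L(P))=\begin{cases}0&\text{if }(-1)^a\cdot\varepsilon\cdot\mathrm{sgn}(t)=+1,\\ 1&\text{if }(-1)^a\cdot\varepsilon\cdot\mathrm{sgn}(t)=-1,\end{cases}$$ where $\mathrm{sgn}(t)=1$ if $t>0$ or $t=0$, and $\mathrm{sgn}(t)=-1$ otherwise.
   Context: **Braids.** Let $\sigma_1,\dots,\sigma_{m-1}$ be the standard positive generators of the braid group of index $m$, with sign chosen so that the closure of $(\sigma_{m-1}\cdots\sigma_1)^q$ ($q>0$) is the positive torus link $T(m,q)$. For $1\le n\le m$ put $W(n)=\sigma_{n-1}\sigma_{n-2}\cdots\sigma_1$ ($W(1)=1$). Knots and links in $S^3$ are unoriented and considered up to isotopy. **Berge's knots.** Parameters: $\delta,\varepsilon\in\{\pm1\}$, a positive integer $A$, $k\in\mathbf{Z}_{\ge0}$, $t\in\mathbf{Z}$; constants $a\in\{0,1\}$, $B>0$, $b\in\mathbf{Z}$ are given by: - Type III: $a=0$, $A\ge2$, $B=A(3+2k)-\varepsilon$, $b=-\delta\varepsilon(2A+tB)$. - Type IV: $a=1$, $A\ge5$ odd, $B=(A(5+2k)-\varepsilon)/2$,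 $b=-\delta\varepsilon(A+tB)$. - Type V: $a=1$, $A\ge3$ odd, $B=A(2+k)+1$ if $\varepsilon=1$ and $B=A(3+k)-1$ if $\varepsilon=-1$, $b=-\delta\varepsilon(A+tB)$. - Type VI: $a=0$, $A\ge4$ even, $\varepsilon=-1$ and $k=0$ fixed, $B=2A+1$, $b=\delta(A-1+tB)$. $K_{\mathcal{X}}(\delta,\varepsilon,A,k,t)$ is the knot in $S^3$ that is the closure of the braid $W(B)^{b}\,W(A+1-a)^{\delta}$ of index $B$ (Berge's braid presentation). Its surgery coefficient as in Type $\mathcal{X}$ is $\mathrm{coef}(K_{\mathcal{X}}(\delta,\varepsilon,A,k,t))=bB+\delta A$ (by Berge, surgery with this coefficient yields a lens space). **L-shaped curves.** Let $X=\{(x,y)\in\mathbf{R}^2:\cos\pi x=\cos\pi y\}$. A lattice point $(m,n)\in\mathbf{Z}^2$ is even (odd) if $m+n$ is even (odd). For positive integers $a_1<a_2$, $b_1<b_2$, let $$L[a_1,a_2;b_1,b_2]=\{0\le x\le a_1,\ 0\le y\le b_2\}\cup\{0\le x\le a_2,\ 0\le y\le b_1\},$$ with concave corner $(a_1,b_1)$. An L-shaped region of type $[a_1,a_2;b_1,b_2]$ is an image of this set under a composition of the reflection in the $x$-axis, rotations by $\pi/2$ about lattice points and translations by lattice points; it is always assumed that its concave corner is at an odd lattice point. The L-shaped curve of this type is $P=X\cap\mathcal{L}$ for such a region $\mathcal{L}$; up to isotopy it depends only on the type. The region is regarded as a disk and $P$, after smoothing its corners, as a divide: the even interior lattice points are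 the double points, $P$ turns back (smoothed, inside the disk) at even lattice points of the boundary which are not corners of the region, and $P$ ends on the boundary at the even corners. $\mathrm{area}(P)$ is the area of the region $\mathcal{L}$, i.e. $a_2b_1+a_1b_2-a_1b_1$. **The curves $P_{\mathcal{X}}(\varepsilon,A,k,t)$.** Let $n=|\beta+tB|$, where $\beta=2A$ in Type III, $\beta=A$ in Types IV and V, $\beta=A-1$ in Type VI. Then $P_{\mathcal{X}}(\varepsilon,A,k,t)$ is the L-shaped curve of type - $[\,B-A+a,\ B;\ n-1,\ n\,]$ if $\varepsilon\cdot\mathrm{sgn}(t)=+1$, - $[\,A+1-a,\ B;\ n,\ n+1\,]$ if $\varepsilon\cdot\mathrm{sgn}(t)=-1$. **Divide links.** For a divide $P$ (a relative generic immersion of a compact 1-manifold in the unit disk $D\subset\mathbf{R}^2$), $$L(P)=\{(x,v)\in D\times\mathbf{R}^2: x\in P,\ v\in T_xP,\ |x|^2+|v|^2=1\}\subset S^3,$$ where $T_xP$ is the set of vectors tangent to some branch of $P$ at $x$, and $S^3\subset\mathbf{R}^2\times\mathbf{R}^2=\mathbf{C}^2$ via $(x,v)\mapsto x+iv$ with the standard orientation. One has $L(P_{\mathcal{X}}(\varepsilon,A,k,t))=K_{\mathcal{X}}(\delta_{\mathcal{X}},\varepsilon,A,k,t)$ with $\delta_{\mathcal{X}}=-\varepsilon\cdot\mathrm{sgn}(t)$, and $\mathrm{coef}(L(P))$ denotes $\mathrm{coef}(K_{\mathcal{X}}(\delta_{\mathcal{X}},\varepsilon,A,k,t))$, i.e.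 $bB+\delta A$ with $\delta=\delta_{\mathcal{X}}$. *)

theory Defs
  imports "HOL-Analysis.Analysis"
begin

definition sgn0 :: "int \<Rightarrow> int" where
  "sgn0 t = (if t \<ge> 0 then 1 else - 1)"


section \<open>Braid words\<close>

text \<open>
  A word in the standard generators is a list of nonzero integers: \<open>i > 0\<close> stands for \<open>\<sigma>\<^sub>i\<close> and
  \<open>- i\<close> for its inverse. Signs are such that the closure of \<open>(\<sigma>\<^bsub>m-1\<^esub> \<dots> \<sigma>\<^sub>1)\<^sup>q\<close>, \<open>q > 0\<close>, is the
  positive torus link \<open>T(m,q)\<close>.
\<close>

definition W :: "nat \<Rightarrow> int list" where
  "W n = rev (map int [1..<n])"

definition braid_inverse :: "int list \<Rightarrow> int list" where
  "braid_inverse w = rev (map uminus w)"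

definition braid_power :: "int list \<Rightarrow> int \<Rightarrow> int list" where
  "braid_power w z =
     concat (replicate (nat \<bar>z\<bar>) (if z \<ge> 0 then w else braid_inverse w))"

text \<open>
  The closure of the braid word \<open>braid\<close> on \<open>strands\<close> strands, together with a surgery coefficient.
  The coefficient is stored with the presentation because it is not an invariant of the knot:
  a knot may admit several lens space surgeries.
\<close>

record braided_surgery =
  strands :: nat
  braid :: "int list"
  coef :: int


section \<open>Berge's knots\<close>

datatype berge_type = III | IV | V | VI

fun admissible :: "berge_type \<Rightarrow> int \<Rightarrow> int \<Rightarrow> nat \<Rightarrow> int \<Rightarrow> bool" where
  "admissible III \<epsilon> A k t \<longleftrightarrow> \<epsilon> \<in> {1, - 1} \<and> A \<ge> 2"
| "admissible IV \<epsilon> A k t \<longleftrightarrow> \<epsilon> \<in> {1, - 1} \<and> A \<ge> 5 \<and> odd A"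
| "admissible V \<epsilon> A k t \<longleftrightarrow> \<epsilon> \<in> {1, - 1} \<and> A \<ge> 3 \<and> odd A"
| "admissible VI \<epsilon> A k t \<longleftrightarrow> \<epsilon> = - 1 \<and> k = 0 \<and> A \<ge> 4 \<and> even A"

fun a_const :: "berge_type \<Rightarrow> nat" where
  "a_const III = 0"
| "a_const IV = 1"
| "a_const V = 1"
| "a_const VI = 0"

text \<open>In Type IV the division is exact, since \<open>A\<close> and \<open>\<epsilon>\<close> are odd.\<close>

fun B_const :: "berge_type \<Rightarrow> int \<Rightarrow> int \<Rightarrow> nat \<Rightarrow> int" where
  "B_const III \<epsilon> A k = A * (3 + 2 * int k) - \<epsilon>"
| "B_const IV \<epsilon> A k = (A * (5 + 2 * int k) - \<epsilon>) div 2"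
| "B_const V \<epsilon> A k = (if \<epsilon> = 1 then A * (2 + int k) + 1 else A * (3 + int k) - 1)"
| "B_const VI \<epsilon> A k = 2 * A + 1"

fun b_const :: "berge_type \<Rightarrow> int \<Rightarrow> int \<Rightarrow> int \<Rightarrow> nat \<Rightarrow> int \<Rightarrow> int" where
  "b_const III \<delta> \<epsilon> A k t = - \<delta> * \<epsilon> * (2 * A + t * B_const III \<epsilon> A k)"
| "b_const IV \<delta> \<epsilon> A k t = - \<delta> * \<epsilon> * (A + t * B_const IV \<epsilon> A k)"
| "b_const V \<delta> \<epsilon> A k t = - \<delta> * \<epsilon> * (A + t * B_const V \<epsilon> A k)"
| "b_const VI \<delta> \<epsilon> A k t = \<delta> * (A - 1 + t * B_const VI \<epsilon> A k)"

definition K :: "berge_type \<Rightarrow> int \<Rightarrow> int \<Rightarrow> int \<Rightarrow> nat \<Rightarrow> int \<Rightarrow> braided_surgery" where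
  "K X \<delta> \<epsilon> A k t =
     (let a = int (a_const X); B = B_const X \<epsilon> A k; b = b_const X \<delta> \<epsilon> A k t in
      \<lparr> strands = nat B,
        braid = braid_power (W (nat B)) b @ braid_power (W (nat (A + 1 - a))) \<delta>,
        coef = b * B + \<delta> * A \<rparr>)"


section \<open>L-shaped curves\<close>

definition diag_grid :: "(real \<times> real) set" where
  "diag_grid = {(x, y). cos (pi * x) = cos (pi * y)}"

definition odd_lattice_point :: "real \<times> real \<Rightarrow> bool" where
  "odd_lattice_point p \<longleftrightarrow> (\<exists>m n :: int. p = (of_int m, of_int n) \<and> odd (m + n))"

definition std_L :: "int \<Rightarrow> int \<Rightarrow> int \<Rightarrow> int \<Rightarrow> (real \<times> real) set" where
  "std_L a1 a2 b1 b2 =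
     {(x, y). 0 \<le> x \<and> x \<le> of_int a1 \<and> 0 \<le> y \<and> y \<le> of_int b2} \<union>
     {(x, y). 0 \<le> x \<and> x \<le> of_int a2 \<and> 0 \<le> y \<and> y \<le> of_int b1}"

text \<open>The rotation is the counterclockwise one by \<open>\<pi>/2\<close> about \<open>(p, q)\<close>; its cube is the clockwise one.\<close>

inductive lattice_motion :: "(real \<times> real \<Rightarrow> real \<times> real) \<Rightarrow> bool" where
  identity: "lattice_motion (\<lambda>z. z)"
| reflection: "lattice_motion f \<Longrightarrow> lattice_motion ((\<lambda>(x, y). (x, - y)) \<circ> f)"
| rotation: "lattice_motion f \<Longrightarrow>
    lattice_motion
      ((\<lambda>(x, y). (of_int p - (y - of_int q), of_int q + (x - of_int p))) \<circ> f)"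
    for p q :: int
| translation: "lattice_motion f \<Longrightarrow>
    lattice_motion ((\<lambda>(x, y). (x + of_int p, y + of_int q)) \<circ> f)"
    for p q :: int

definition L_shaped_region :: "int \<Rightarrow> int \<Rightarrow> int \<Rightarrow> int \<Rightarrow> (real \<times> real) set \<Rightarrow> bool" where
  "L_shaped_region a1 a2 b1 b2 R \<longleftrightarrow>
     0 < a1 \<and> a1 < a2 \<and> 0 < b1 \<and> b1 < b2 \<and>
     (\<exists>f. lattice_motion f \<and> odd_lattice_point (f (of_int a1, of_int b1)) \<and>
          R = f ` std_L a1 a2 b1 b2)"

text \<open>
  A divide is a curve in a disk, so an L-shaped curve is recorded as a pair of the region, which
  plays the role of the disk, and the curve in it. An L-shaped curve is determined by its type only
  up to isotopy; hence a type gives a set of such pairs.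
\<close>

definition L_shaped_curves ::
  "int \<Rightarrow> int \<Rightarrow> int \<Rightarrow> int \<Rightarrow> ((real \<times> real) set \<times> (real \<times> real) set) set" where
  "L_shaped_curves a1 a2 b1 b2 =
     {(R, diag_grid \<inter> R) | R. L_shaped_region a1 a2 b1 b2 R}"

definition area :: "(real \<times> real) set \<times> (real \<times> real) set \<Rightarrow> real" where
  "area P = measure lebesgue (fst P)"


section \<open>The L-shaped curves of Berge's knots\<close>

fun beta_const :: "berge_type \<Rightarrow> int \<Rightarrow> int" where
  "beta_const III A = 2 * A"
| "beta_const IV A = A"
| "beta_const V A = A"
| "beta_const VI A = A - 1"

definition P_curves ::
  "berge_type \<Rightarrow> int \<Rightarrow> int \<Rightarrow> nat \<Rightarrow> int \<Rightarrow> ((real \<times> real) set \<times> (real \<times> real) set) set" where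
  "P_curves X \<epsilon> A k t =
     (let a = int (a_const X); B = B_const X \<epsilon> A k; n = \<bar>beta_const X A + t * B\<bar> in
      if \<epsilon> * sgn0 t = 1 then L_shaped_curves (B - A + a) B (n - 1) n
      else L_shaped_curves (A + 1 - a) B n (n + 1))"

text \<open>
  The divide link of a curve in \<open>P_curves X \<epsilon> A k t\<close> is \<open>K X (delta_of \<epsilon> t) \<epsilon> A k t\<close>, and its
  coefficient is by convention the one carried by this presentation.
\<close>

definition delta_of :: "int \<Rightarrow> int \<Rightarrow> int" where
  "delta_of \<epsilon> t = - \<epsilon> * sgn0 t"

lemma L_shaped_curves_nonempty:
  assumes "0 < a1" "a1 < a2" "0 < b1" "b1 < b2"
  shows "L_shaped_curves a1 a2 b1 b2 \<noteq> {}"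
proof -
  let ?f = "(\<lambda>(x, y). (x + of_int (1 - a1 :: int), y + of_int (- b1 :: int))) \<circ> (\<lambda>z :: real \<times> real. z)"
  have "lattice_motion ?f"
    by (rule lattice_motion.translation, rule lattice_motion.identity)
  moreover have "odd_lattice_point (?f (of_int a1, of_int b1))"
    unfolding odd_lattice_point_def by (intro exI[of _ 1] exI[of _ 0]) auto
  ultimately have "L_shaped_region a1 a2 b1 b2 (?f ` std_L a1 a2 b1 b2)"
    unfolding L_shaped_region_def using assms by blast
  then show ?thesis
    unfolding L_shaped_curves_def by blast
qed

lemma abs_affine_lower_bound:
  fixes \<beta> B t :: int
  assumes "0 < \<beta>" "\<beta> < B"
  shows "\<bar>\<beta> + t * B\<bar> \<ge> (if t \<ge> 0 then \<beta> else B - \<beta>)"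
proof (cases "t \<ge> 0")
  case True
  then have "t * B \<ge> 0" using assms by simp
  then show ?thesis using True by simp
next
  case False
  then have "t * B \<le> (- 1) * B" using assms by (intro mult_right_mono) auto
  then show ?thesis using False by simp
qed

lemma B_const_bounds:
  assumes "admissible X \<epsilon> A k t"
  shows "0 < beta_const X A \<and> 0 < B_const X \<epsilon> A k - beta_const X A \<and>
    A + 1 < B_const X \<epsilon> A k \<and> 2 \<le> A \<and> int (a_const X) \<in> {0, 1} \<and>
    (\<epsilon> = 1 \<longrightarrow> 2 \<le> beta_const X A) \<and>
    (\<epsilon> = - 1 \<longrightarrow> 2 \<le> B_const X \<epsilon> A k - beta_const X A) \<and> \<epsilon> \<in> {1, - 1}"
proof -
  have A: "2 \<le> A" using assms by (cases X) auto
  define m where "m = A * int k"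
  have m: "m \<ge> 0" using A by (simp add: m_def)
  have e:
    "A * (3 + 2 * int k) = 3 * A + 2 * m" "A * (5 + 2 * int k) = 5 * A + 2 * m"
    "A * (2 + int k) = 2 * A + m" "A * (3 + int k) = 3 * A + m"
    unfolding m_def by (simp_all add: distrib_left)
  show ?thesis
  proof (cases X)
    case IV
    have "2 * A + 2 \<le> (5 * A + 2 * m - \<epsilon>) div 2"
      using assms m IV by (auto simp: algebra_simps)
    then show ?thesis using assms m A IV by (auto simp: e)
  qed (use assms m A in \<open>auto simp: e\<close>)
qed

lemma P_curves_nonempty:
  assumes "admissible X \<epsilon> A k t"
  shows "P_curves X \<epsilon> A k t \<noteq> {}"
proof -
  note bnd = B_const_bounds[OF assms]
  define n where "n = \<bar>beta_const X A + t * B_const X \<epsilon> A k\<bar>"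
  have n: "n \<ge> (if t \<ge> 0 then beta_const X A else B_const X \<epsilon> A k - beta_const X A)"
    unfolding n_def using bnd by (intro abs_affine_lower_bound) auto
  show ?thesis
  proof (cases "\<epsilon> * sgn0 t = 1")
    case True
    then have "2 \<le> n" using n bnd by (auto simp: sgn0_def split: if_splits)
    then have "L_shaped_curves (B_const X \<epsilon> A k - A + int (a_const X)) (B_const X \<epsilon> A k)
        (n - 1) n \<noteq> {}"
      using bnd by (intro L_shaped_curves_nonempty) auto
    with True show ?thesis by (simp add: P_curves_def Let_def n_def)
  next
    case False
    have "1 \<le> n" using n bnd by (auto split: if_splits)
    then have "L_shaped_curves (A + 1 - int (a_const X)) (B_const X \<epsilon> A k) n (n + 1) \<noteq> {}"
      using bnd by (intro L_shaped_curves_nonempty) auto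
    with False show ?thesis by (simp add: P_curves_def Let_def n_def)
  qed
qed

end

theory Submission
  imports Defs
begin

text \<open>
  Lattice motions are isometries, so the area of an L-shaped curve is the area
  \<open>a\<^sub>2b\<^sub>1 + a\<^sub>1b\<^sub>2 - a\<^sub>1b\<^sub>1\<close> of the standard region of its type. This invariance can be
  seen on rectangles alone: the generating motions send rectangles with sides parallel to the axes
  to such rectangles of equal area
  (\<open>lattice_motion_image_rectangle\<close>). The standard region is the union of two rectangles that meet in
  a third one, and inclusion-exclusion then gives its area and that of every image
  (\<open>measure_L_shaped_region\<close>).

  On the knot side, the choice \<open>\<delta> = - \<epsilon> sgn t\<close> turns the exponent \<open>b\<close> into
  \<open>sgn t (\<beta> + tB)\<close>. Since \<open>0 < \<beta> < B\<close>, the number \<open>\<beta> + tB\<close> is positive for \<open>t \<ge> 0\<close> and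
  negative for \<open>t < 0\<close>, so \<open>b = \<bar>\<beta> + tB\<bar> = n\<close>, and the coefficient is \<open>nB - \<epsilon> sgn t A\<close>.
  Both possible types of region have height difference \<open>b\<^sub>2 - b\<^sub>1 = 1\<close> and \<open>a\<^sub>2 = B\<close>, so their
  area is \<open>b\<^sub>1B + a\<^sub>1\<close>: this is \<open>nB - A + a\<close> for \<open>\<epsilon> sgn t = 1\<close> and \<open>nB + A + 1 - a\<close> for
  \<open>\<epsilon> sgn t = -1\<close>. The difference from the coefficient is \<open>a\<close> in the first case and \<open>1 - a\<close>
  in the second.
\<close>

definition rectangle_of_area :: "real \<Rightarrow> (real \<times> real) set \<Rightarrow> bool" where
  "rectangle_of_area w R \<longleftrightarrow>
     (\<exists>a b c d. a \<le> b \<and> c \<le> d \<and> R = {a..b} \<times> {c..d} \<and> w = (b - a) * (d - c))"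

lemma rectangle_of_areaI:
  assumes "a \<le> b" "c \<le> d" "R = {a..b} \<times> {c..d}" "w = (b - a) * (d - c)"
  shows "rectangle_of_area w R"
  using assms unfolding rectangle_of_area_def by blast

lemma rectangle_of_area_measure:
  assumes "rectangle_of_area w R"
  shows "R \<in> lmeasurable" "measure lebesgue R = w"
proof -
  obtain a b c d where abcd: "a \<le> b" "c \<le> d" "w = (b - a) * (d - c)"
    and R: "R = {a..b} \<times> {c..d}"
    using assms unfolding rectangle_of_area_def by blast
  have R': "R = cbox (a, c) (b, d)"
    using R by (simp add: cbox_Pair_eq)
  show "R \<in> lmeasurable"
    unfolding R' by (rule lmeasurable_cbox)
  show "measure lebesgue R = w"
    using abcd unfolding R' by (simp add: content_Pair)
qed

lemma lattice_motion_inj: "lattice_motion f \<Longrightarrow> inj f"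
proof (induction rule: lattice_motion.induct)
  case identity
  show ?case by simp
qed (rule inj_compose, rule injI, force, assumption)+

text \<open>
  Up to translation, a generating motion permutes the coordinates with signs, so sides stay parallel
  to the axes and keep their lengths; a rotation by \<open>\<pi>/2\<close> exchanges the two side lengths, which does
  not change their product.
\<close>

lemma lattice_motion_image_rectangle:
  assumes "lattice_motion f" and "rectangle_of_area w R"
  shows "rectangle_of_area w (f ` R)"
  using assms
proof (induction rule: lattice_motion.induct)
  case identity
  then show ?case by simp
next
  case (reflection f)
  then obtain a b c d where r: "a \<le> b" "c \<le> d" "w = (b - a) * (d - c)"
    "f ` R = {a..b} \<times> {c..d}"
    unfolding rectangle_of_area_def by blast
  have "((\<lambda>(x, y). (x, - y)) \<circ> f) ` R = {a..b} \<times> {- d..- c}" (is "_ = ?T")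
    unfolding image_comp[symmetric] r(4)
  proof (intro equalityI subsetI)
    fix z assume z: "z \<in> ?T"
    show "z \<in> (\<lambda>(x, y). (x, - y)) ` ({a..b} \<times> {c..d})"
      using z by (intro image_eqI[of _ _ "(fst z, - snd z)"]) auto
  qed auto
  then show ?case
    using r by (intro rectangle_of_areaI[of a b "- d" "- c"]) auto
next
  case (rotation p q f)
  then obtain a b c d where r: "a \<le> b" "c \<le> d" "w = (b - a) * (d - c)"
    "f ` R = {a..b} \<times> {c..d}"
    unfolding rectangle_of_area_def by blast
  let ?p = "of_int p :: real" and ?q = "of_int q :: real"
  have "((\<lambda>(x, y). (?p - (y - ?q), ?q + (x - ?p))) \<circ> f) ` R
      = {?p + ?q - d..?p + ?q - c} \<times> {?q - ?p + a..?q - ?p + b}" (is "_ = ?T")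
    unfolding image_comp[symmetric] r(4)
  proof (intro equalityI subsetI)
    fix z assume z: "z \<in> ?T"
    \<comment> \<open>the inverse rotation applied to \<open>z\<close>\<close>
    show "z \<in> (\<lambda>(x, y). (?p - (y - ?q), ?q + (x - ?p))) ` ({a..b} \<times> {c..d})"
      using z by (intro image_eqI[of _ _ "(snd z - ?q + ?p, ?p + ?q - fst z)"]) auto
  qed auto
  then show ?case
    using r by (intro rectangle_of_areaI[of "?p + ?q - d" "?p + ?q - c" "?q - ?p + a" "?q - ?p + b"])
      (auto simp: algebra_simps)
next
  case (translation p q f)
  then obtain a b c d where r: "a \<le> b" "c \<le> d" "w = (b - a) * (d - c)"
    "f ` R = {a..b} \<times> {c..d}"
    unfolding rectangle_of_area_def by blast
  let ?p = "of_int p :: real" and ?q = "of_int q :: real"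
  have "((\<lambda>(x, y). (x + ?p, y + ?q)) \<circ> f) ` R = {a + ?p..b + ?p} \<times> {c + ?q..d + ?q}" (is "_ = ?T")
    unfolding image_comp[symmetric] r(4)
  proof (intro equalityI subsetI)
    fix z assume z: "z \<in> ?T"
    show "z \<in> (\<lambda>(x, y). (x + ?p, y + ?q)) ` ({a..b} \<times> {c..d})"
      using z by (intro image_eqI[of _ _ "(fst z - ?p, snd z - ?q)"]) auto
  qed auto
  then show ?case
    using r by (intro rectangle_of_areaI[of "a + ?p" "b + ?p" "c + ?q" "d + ?q"]) auto
qed

text \<open>
  The arms of the L are \<open>[0,a\<^sub>1] \<times> [0,b\<^sub>2]\<close> and \<open>[0,a\<^sub>2] \<times> [0,b\<^sub>1]\<close>, and they meet in
  \<open>[0,a\<^sub>1] \<times> [0,b\<^sub>1]\<close>. A lattice motion is injective, so it respects this intersection, and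
  inclusion-exclusion can be applied to the image.
\<close>

lemma measure_L_shaped_region:
  assumes "L_shaped_region a1 a2 b1 b2 R"
  shows "measure lebesgue R = of_int (a2 * b1 + a1 * b2 - a1 * b1)"
proof -
  obtain f where f: "lattice_motion f" and R: "R = f ` std_L a1 a2 b1 b2"
    and pos: "0 < a1" "a1 < a2" "0 < b1" "b1 < b2"
    using assms unfolding L_shaped_region_def by blast
  define box :: "int \<Rightarrow> int \<Rightarrow> (real \<times> real) set"
    where "box u v = {0..of_int u} \<times> {0..of_int v}" for u v
  have rect: "rectangle_of_area (of_int (u * v)) (f ` box u v)" if "0 < u" "0 < v" for u v
    using that by (intro lattice_motion_image_rectangle[OF f]
        rectangle_of_areaI[of 0 "of_int u" 0 "of_int v"]) (auto simp: box_def)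
  have union: "R = f ` box a1 b2 \<union> f ` box a2 b1"
    unfolding R image_Un[symmetric] by (auto simp: std_L_def box_def)
  have "box a1 b2 \<inter> box a2 b1 = box a1 b1"
    using pos by (auto simp: box_def)
  then have inter: "f ` box a1 b2 \<inter> f ` box a2 b1 = f ` box a1 b1"
    using lattice_motion_inj[OF f] by (metis image_Int)
  have "measure lebesgue R = measure lebesgue (f ` box a1 b2)
      + measure lebesgue (f ` box a2 b1) - measure lebesgue (f ` box a1 b1)"
    unfolding union inter[symmetric] using pos
    by (intro measure_Un3 rectangle_of_area_measure(1)[OF rect]) auto
  also have "\<dots> = of_int (a1 * b2) + of_int (a2 * b1) - of_int (a1 * b1)"
    using pos by (simp only: rectangle_of_area_measure(2)[OF rect] order.strict_trans)
  finally show ?thesis by simp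
qed

lemma area_L_shaped_curves:
  assumes "P \<in> L_shaped_curves a1 a2 b1 b2"
  shows "area P = of_int (a2 * b1 + a1 * b2 - a1 * b1)"
  using assms measure_L_shaped_region unfolding L_shaped_curves_def area_def by auto

lemma abs_affine_eq_sgn0_mult:
  assumes "0 < \<beta>" "\<beta> < B"
  shows "\<bar>\<beta> + t * B\<bar> = sgn0 t * (\<beta> + t * B)"
proof (cases "t \<ge> 0")
  case True
  then have "0 \<le> t * B" using assms by simp
  then show ?thesis using True assms by (simp add: sgn0_def)
next
  case False
  then have "t * B \<le> (- 1) * B" using assms by (intro mult_right_mono) auto
  then show ?thesis using False assms by (simp add: sgn0_def)
qed

text \<open>
  In Types III, IV and V the factor \<open>- \<delta>\<epsilon>\<close> of \<open>b\<close> equals \<open>\<epsilon>\<^sup>2 sgn t = sgn t\<close>; in Type VI the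
  factor is \<open>\<delta>\<close>, which is again \<open>sgn t\<close> because \<open>\<epsilon> = -1\<close>.
\<close>

lemma b_const_delta_of:
  assumes "admissible X \<epsilon> A k t"
  shows "b_const X (delta_of \<epsilon> t) \<epsilon> A k t = \<bar>beta_const X A + t * B_const X \<epsilon> A k\<bar>"
proof -
  have "b_const X (delta_of \<epsilon> t) \<epsilon> A k t = sgn0 t * (beta_const X A + t * B_const X \<epsilon> A k)"
    using assms by (cases X) (auto simp: delta_of_def)
  then show ?thesis
    using B_const_bounds[OF assms] by (simp add: abs_affine_eq_sgn0_mult)
qed

lemma coef_delta_of:
  assumes "admissible X \<epsilon> A k t"
  shows "coef (K X (delta_of \<epsilon> t) \<epsilon> A k t) =
    \<bar>beta_const X A + t * B_const X \<epsilon> A k\<bar> * B_const X \<epsilon> A k - \<epsilon> * sgn0 t * A"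
  by (simp add: K_def Let_def b_const_delta_of[OF assms]) (simp add: delta_of_def)

theorem lemma5p3:
  fixes X :: berge_type and \<epsilon> A t :: int and k :: nat
    and P :: "(real \<times> real) set \<times> (real \<times> real) set"
  assumes "admissible X \<epsilon> A k t"
    and "P \<in> P_curves X \<epsilon> A k t"
  shows "((- 1) ^ a_const X * \<epsilon> * sgn0 t = 1 \<longrightarrow>
            area P - of_int (coef (K X (delta_of \<epsilon> t) \<epsilon> A k t)) = 0) \<and>
         ((- 1) ^ a_const X * \<epsilon> * sgn0 t = - 1 \<longrightarrow>
            area P - of_int (coef (K X (delta_of \<epsilon> t) \<epsilon> A k t)) = 1)"
proof -
  define B where "B = B_const X \<epsilon> A k"
  define a where "a = int (a_const X)"
  define n where "n = \<bar>beta_const X A + t * B\<bar>"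
  have coef: "coef (K X (delta_of \<epsilon> t) \<epsilon> A k t) = n * B - \<epsilon> * sgn0 t * A"
    using coef_delta_of[OF assms(1)] by (simp add: n_def B_def)
  have a: "a_const X = 0 \<and> a = 0 \<or> a_const X = 1 \<and> a = 1"
    unfolding a_def by (cases X) auto
  have "\<epsilon> \<in> {1, - 1}" using B_const_bounds[OF assms(1)] by blast
  then consider (plus) "\<epsilon> * sgn0 t = 1" | (minus) "\<epsilon> * sgn0 t = - 1"
    by (cases "t \<ge> 0") (auto simp: sgn0_def)
  then show ?thesis
  proof cases
    case plus
    then have "P \<in> L_shaped_curves (B - A + a) B (n - 1) n"
      using assms(2) by (simp add: P_curves_def Let_def B_def a_def n_def)
    then have "area P - of_int (coef (K X (delta_of \<epsilon> t) \<epsilon> A k t)) = of_int a"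
      by (simp add: area_L_shaped_curves coef plus algebra_simps)
    then show ?thesis using a plus by (auto simp: mult.assoc)
  next
    case minus
    then have "P \<in> L_shaped_curves (A + 1 - a) B n (n + 1)"
      using assms(2) by (simp add: P_curves_def Let_def B_def a_def n_def)
    then have "area P - of_int (coef (K X (delta_of \<epsilon> t) \<epsilon> A k t)) = of_int (1 - a)"
      by (simp add: area_L_shaped_curves coef minus algebra_simps)
    then show ?thesis using a minus by (auto simp: mult.assoc)
  qed
qed

end
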